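(* Let $X$ be a unital $C^{\ast}$-algebra, let $X_{sa}$ be the set of its self-adjoint elements, and let $n$ be a non-negative integer. Then the following conditions are equivalent: (i) $\operatorname{rr}(X)\leq n$. (ii) For each $(n+1)$-tuple $(x_1,\dots,x_{n+1})$ in $X_{sa}$ and for each $\epsilon>0$, there exists an $(n+1)$-tuple $(y_1,\dots,y_{n+1})$ in $X_{sa}$ such that $\sum_{k=1}^{n+1}y_k^2$ is invertible and $\|x_k-y_k\|<\epsilon$ for each $k=1,2,\dots,n+1$. (iii) For any sequence $\{x_i : i\in\mathbb{N}\}\subseteq X_{sa}$ and for any sequence of positive real numbers $\{\epsilon_i : i\in\mathbb{N}\}$ there exists a sequence $\{y_i : i\in\mathbb{N}\}\subseteq X_{sa}$ such that (a) $\|x_i-y_i\|<\epsilon_i$ for each $i\in\mathbb{N}$, and (b) for any subset $D\subseteq\mathbb{N}$ with $|D|=n+1$, the element $\sum_{i\in D}y_i^2$ is invertible. (iv) For any sequence $\{x_i : i\in\mathbb{N}\}\subseteq X_{sa}$ and for any $\epsilon>0$ there exists a sequence $\{y_i : i\in\mathbb{N}\}\subseteq X_{sa}$ such that (a) $\|x_i-y_i\|<\epsilon$ for each $i\in\mathbb{N}$, and (b) for any subset $D\subseteq\mathbb{N}$ with $|D|=n+1$, the element $\sum_{i\in D}y_i^2$ is invertible. (v) For any sequence $\{x_i : i\in\mathbb{N}\}\subseteq X_{sa}$ such that $\|x_i\|=1$ for each $i\in\mathbb{N}$ and for any $\epsilon>0$ there exists a sequence $\{y_i : i\in\mathbb{N}\}\subseteq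 X_{sa}$ such that (a) $\|x_i-y_i\|<\epsilon$ for each $i\in\mathbb{N}$, and (b) for any subset $D\subseteq\mathbb{N}$ with $|D|=n+1$, the element $\sum_{i\in D}y_i^2$ is invertible.
   Context: $\mathbb{N}=\{1,2,\dots\}$. Real rank: for a unital $C^{\ast}$-algebra $X$, one says $\operatorname{rr}(X)\leq n$ if for each $(n+1)$-tuple $(x_1,\dots,x_{n+1})$ of self-adjoint elements of $X$ and every $\epsilon>0$ there exists an $(n+1)$-tuple $(y_1,\dots,y_{n+1})$ of self-adjoint elements of $X$ such that $\sum_{k=1}^{n+1}y_k^2$ is invertible and $\left\|\sum_{k=1}^{n+1}(x_k-y_k)^2\right\|<\epsilon$. *)

theory Defs
  imports Complex_Main
begin

text \<open>
  Unital (complex) C*-algebras. Completeness and submultiplicativity of the norm come from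
  \<^class>\<open>banach\<close> and \<^class>\<open>real_normed_algebra_1\<close>; the latter also fixes the usual conventions
  \<open>0 \<noteq> 1\<close> and \<open>norm 1 = 1\<close>. The real scalar multiplication of these classes is required to be the
  restriction of the complex one, so that \<open>scaleC 1 x = x\<close> need not be assumed separately.
\<close>

class cstar_algebra_1 = real_normed_algebra_1 + banach +
  fixes scaleC :: "complex \<Rightarrow> 'a \<Rightarrow> 'a"
    and star :: "'a \<Rightarrow> 'a"
  assumes scaleR_eq_scaleC: "scaleR r x = scaleC (complex_of_real r) x"
    and scaleC_add_right: "scaleC c (x + y) = scaleC c x + scaleC c y"
    and scaleC_add_left: "scaleC (c + d) x = scaleC c x + scaleC d x"
    and scaleC_scaleC: "scaleC c (scaleC d x) = scaleC (c * d) x"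
    and mult_scaleC_left: "scaleC c x * y = scaleC c (x * y)"
    and mult_scaleC_right: "x * scaleC c y = scaleC c (x * y)"
    and norm_scaleC: "norm (scaleC c x) = cmod c * norm x"
    and star_star: "star (star x) = x"
    and star_add: "star (x + y) = star x + star y"
    and star_scaleC: "star (scaleC c x) = scaleC (cnj c) (star x)"
    and star_mult: "star (x * y) = star y * star x"
    and cstar_identity: "norm (star x * x) = (norm x)\<^sup>2"

instantiation complex :: cstar_algebra_1
begin

definition scaleC_complex :: "complex \<Rightarrow> complex \<Rightarrow> complex"
  where "scaleC_complex c x = c * x"

definition star_complex :: "complex \<Rightarrow> complex"
  where "star_complex x = cnj x"

instance
  by standard
    (simp_all add: scaleC_complex_def star_complex_def scaleR_conv_of_real algebra_simps
      norm_mult power2_eq_square)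

end

definition self_adjoints :: "'a::cstar_algebra_1 set"
  where "self_adjoints = {x. star x = x}"

text \<open>Two-sided invertibility; the algebra need not be commutative.\<close>

definition invertible_elem :: "'a::monoid_mult \<Rightarrow> bool"
  where "invertible_elem x \<longleftrightarrow> (\<exists>z. x * z = 1 \<and> z * x = 1)"

text \<open>
  \<open>real_rank_le TYPE('a) n\<close> says that the real rank of the algebra \<open>'a\<close> is at most \<open>n\<close>.
  An \<open>(n + 1)\<close>-tuple is a function on \<open>nat\<close> of which only the values on \<open>{1..n + 1}\<close> matter.
\<close>

definition real_rank_le :: "'a::cstar_algebra_1 itself \<Rightarrow> nat \<Rightarrow> bool"
  where "real_rank_le _ n \<longleftrightarrow>
    (\<forall>x :: nat \<Rightarrow> 'a. \<forall>\<epsilon>::real. (\<forall>k\<in>{1..n+1}. x k \<in> self_adjoints) \<and> \<epsilon> > 0 \<longrightarrow>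
      (\<exists>y :: nat \<Rightarrow> 'a. (\<forall>k\<in>{1..n+1}. y k \<in> self_adjoints) \<and>
        invertible_elem (\<Sum>k=1..n+1. (y k)\<^sup>2) \<and>
        norm (\<Sum>k=1..n+1. (x k - y k)\<^sup>2) < \<epsilon>))"

end

(* Call p nonnegative if it is self-adjoint and norm (t - p) <= t for some t > 0; such elements
   visibly form a cone, and p + delta has a self-adjoint square root (binomial series) commuting
   with everything that commutes with p. If b is a square root of 1 - a^2, then a + ib is unitary;
   so squares are nonnegative, and norm (a_k)^2 <= norm (sum a_j^2), which gives (i) <-> (ii).
   For (ii) -> (iii), the sequences for which the sum over D is invertible form a dense open subset
   of a closed box of sequences for each of the countably many D, and Baire's theorem applies.
   For (v) -> (ii), normalise the x_k and scale back: if sum a_k^2 is invertible, it is bounded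
   below by a positive scalar, hence so is sum c_k^2 a_k^2 for nonzero real c_k. *)

theory Submission
  imports Defs "HOL-Analysis.Analysis"
begin

section \<open>The involution and the real space of self-adjoint elements\<close>

lemma star_scaleR: "star (r *\<^sub>R x) = r *\<^sub>R star (x::'a::cstar_algebra_1)"
  by (simp add: scaleR_eq_scaleC star_scaleC)

text \<open>The C*-identity and submultiplicativity bound \<open>norm y\<close> by
  \<open>norm (star y)\<close>. Since \<open>star\<close> is an involution, the same bound at
  \<open>star x\<close> gives the converse.\<close>

lemma norm_star [simp]: "norm (star x) = norm (x::'a::cstar_algebra_1)"
proof -
  have le: "norm y \<le> norm (star y)" for y :: 'a
  proof (cases "y = 0")
    case False
    have "norm y * norm y \<le> norm (star y) * norm y"
      using norm_mult_ineq[of "star y" y] by (simp add: cstar_identity power2_eq_square)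
    then show ?thesis using False by simp
  qed auto
  show ?thesis using le[of x] le[of "star x"] by (simp add: star_star)
qed

lemma bounded_linear_star: "bounded_linear (star :: 'a::cstar_algebra_1 \<Rightarrow> 'a)"
  by (rule bounded_linear_intro[of _ 1]) (simp_all add: star_add star_scaleR)

lemma star_zero [simp]: "star (0::'a::cstar_algebra_1) = 0"
  using star_scaleR[of 0 "0::'a"] by simp

lemma star_diff: "star (x - y) = star x - star (y::'a::cstar_algebra_1)"
  using star_add[of "x - y" y] by (simp add: algebra_simps)

lemma star_one [simp]: "star (1::'a::cstar_algebra_1) = 1"
  by (metis mult.left_neutral star_mult star_star)

lemma star_power: "star (x ^ n) = star (x::'a::cstar_algebra_1) ^ n"
  by (induction n) (simp_all add: star_mult power_commutes)

lemma closed_self_adjoints: "closed (self_adjoints :: 'a::cstar_algebra_1 set)"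
  unfolding self_adjoints_def
  by (intro closed_Collect_eq linear_continuous_on bounded_linear_star continuous_on_id)

lemma self_adjoints_intros [intro, simp]:
  fixes x y :: "'a::cstar_algebra_1"
  shows "0 \<in> (self_adjoints :: 'a set)" "1 \<in> (self_adjoints :: 'a set)"
    "x \<in> self_adjoints \<Longrightarrow> y \<in> self_adjoints \<Longrightarrow> x + y \<in> self_adjoints"
    "x \<in> self_adjoints \<Longrightarrow> y \<in> self_adjoints \<Longrightarrow> x - y \<in> self_adjoints"
    "x \<in> self_adjoints \<Longrightarrow> r *\<^sub>R x \<in> self_adjoints"
    "x \<in> self_adjoints \<Longrightarrow> x ^ k \<in> self_adjoints"
  by (auto simp: self_adjoints_def star_add star_diff star_scaleR star_power)

lemma self_adjoints_sum [intro]: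
  "(\<And>i. i \<in> A \<Longrightarrow> f i \<in> self_adjoints) \<Longrightarrow> (\<Sum>i\<in>A. f i) \<in> (self_adjoints :: 'a::cstar_algebra_1 set)"
  by (induction A rule: infinite_finite_induct) auto

lemma self_adjoints_mult:
  fixes x y :: "'a::cstar_algebra_1"
  shows "x \<in> self_adjoints \<Longrightarrow> y \<in> self_adjoints \<Longrightarrow> x * y = y * x \<Longrightarrow> x * y \<in> self_adjoints"
  by (simp add: self_adjoints_def star_mult)

lemma norm_square_self_adjoint:
  "x \<in> self_adjoints \<Longrightarrow> norm (x\<^sup>2) = (norm (x::'a::cstar_algebra_1))\<^sup>2"
  using cstar_identity[of x] by (simp add: self_adjoints_def power2_eq_square)

section \<open>Square roots from the binomial series\<close>

lemma abs_gbinomial_half_le_1: "\<bar>(1/2::real) gchoose n\<bar> \<le> 1"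
proof (induction n)
  case (Suc n)
  have eq: "(1/2::real) gchoose Suc n = ((1/2) gchoose n) * ((1/2 - real n) / real (Suc n))"
    using gbinomial_mult_1[of "1/2::real" n] by (simp add: field_simps)
  \<comment> \<open>The ratio of consecutive coefficients has modulus at most 1, so the bound
    propagates from the coefficient 1 at n = 0.\<close>
  have "\<bar>(1/2 - real n) / real (Suc n)\<bar> \<le> 1" by (simp add: abs_if divide_simps)
  then show ?case
    unfolding eq abs_mult using Suc.IH by (intro mult_le_one) auto
qed simp

text \<open>The root is the binomial series of (1 - x)^(1/2), dominated by a geometric series. As a
  limit of real polynomials in x it is self-adjoint and commutes with everything that commutes with
  x.\<close>

lemma sqrt_one_minus:
  fixes x :: "'a::cstar_algebra_1"
  assumes "x \<in> self_adjoints" "norm x < 1"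
  obtains q where "q \<in> self_adjoints" "q\<^sup>2 = 1 - x" "\<And>y. x * y = y * x \<Longrightarrow> q * y = y * q"
proof -
  define a :: "nat \<Rightarrow> real" where "a n = (-1)^n * ((1/2) gchoose n)" for n
  define f where "f n = a n *\<^sub>R x ^ n" for n
  have a_le: "\<bar>a n\<bar> \<le> 1" for n
    using abs_gbinomial_half_le_1[of n] by (simp add: a_def abs_mult power_abs)
  \<comment> \<open>By Vandermonde, squaring the series with exponent 1/2 yields the coefficients of
    the series with exponent 1.\<close>
  have conv: "(\<Sum>i\<le>n. a i * a (n - i)) = (-1)^n * (1 gchoose n)" for n
  proof -
    have "(\<Sum>i\<le>n. a i * a (n - i)) =
        (\<Sum>i\<le>n. (-1)^n * (((1/2) gchoose i) * ((1/2) gchoose (n - i))))"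
    proof (rule sum.cong)
      fix i assume "i \<in> {..n}"
      then have "(-1)^n = (-1::real)^i * (-1)^(n - i)" by (simp flip: power_add)
      then show "a i * a (n - i) = (-1)^n * (((1/2) gchoose i) * ((1/2) gchoose (n - i)))"
        by (simp add: a_def)
    qed simp
    then show ?thesis
      using gbinomial_Vandermonde[of "1/2::real" "1/2" n]
      by (simp add: atMost_atLeast0 flip: sum_distrib_left)
  qed
  have nsum: "summable (\<lambda>n. norm (f n))"
  proof (rule summable_comparison_test)
    show "summable (\<lambda>n. norm x ^ n)" using assms by (simp add: summable_geometric)
    have "norm (f n) \<le> norm x ^ n" for n
      using mult_mono[OF a_le[of n] norm_power_ineq[of x n]] by (simp add: f_def)
    then show "\<exists>N. \<forall>n\<ge>N. norm (norm (f n)) \<le> norm x ^ n" by simp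
  qed
  then have sum_f: "summable f" by (rule summable_norm_cancel)
  define q where "q = suminf f"
  have "q * q = (\<Sum>n. \<Sum>i\<le>n. f i * f (n - i))"
    unfolding q_def by (rule Cauchy_product[OF nsum nsum])
  also have "(\<lambda>n. \<Sum>i\<le>n. f i * f (n - i)) = (\<lambda>n. ((-1)^n * (1 gchoose n)) *\<^sub>R x ^ n)"
    by (auto simp: f_def conv[symmetric] scaleR_left.sum fun_eq_iff simp flip: power_add
        intro!: sum.cong)
  \<comment> \<open>The binomial coefficients of exponent 1 vanish from n = 2 on, which leaves the
    polynomial 1 - x.\<close>
  also have "suminf \<dots> = (\<Sum>n\<in>{0,1}. ((-1)^n * (1 gchoose n)) *\<^sub>R x ^ n)"
  proof (rule suminf_finite)
    fix n :: nat assume "n \<notin> {0,1}"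
    then have "1 < n" by auto
    then show "((-1)^n * (1 gchoose n)) *\<^sub>R x ^ n = 0"
      using binomial_gbinomial[of 1 n, where 'a=real] by (simp add: binomial_eq_0)
  qed simp
  also have "\<dots> = 1 - x" by simp
  finally have "q\<^sup>2 = 1 - x" by (simp add: power2_eq_square)
  moreover have "star (f n) = f n" for n
    using assms(1) by (simp add: f_def star_scaleR star_power self_adjoints_def)
  then have "star q = q"
    unfolding q_def using bounded_linear.suminf[OF bounded_linear_star sum_f] by simp
  moreover have "q * y = y * q" if "x * y = y * x" for y
  proof -
    have "x ^ n * y = y * x ^ n" for n
      by (induction n) (simp_all add: mult.assoc that, metis mult.assoc that)
    then show ?thesis
      unfolding q_def suminf_mult[OF sum_f, symmetric] suminf_mult2[OF sum_f]
      by (simp add: f_def)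
  qed
  ultimately show thesis using that by (auto simp: self_adjoints_def)
qed

section \<open>The cone of nonnegative elements, described by a norm bound in place of the
  spectrum\<close>

definition nonneg_elem :: "'a::cstar_algebra_1 \<Rightarrow> bool"
  where "nonneg_elem p \<longleftrightarrow> p \<in> self_adjoints \<and> (\<exists>t>0. norm (t *\<^sub>R 1 - p) \<le> t)"

text \<open>The witnesses add by the triangle inequality; letting \<open>t\<close> vary in the
  definition makes closure under sums immediate.\<close>

lemma nonneg_elem_add:
  assumes "nonneg_elem p" "nonneg_elem q"
  shows "nonneg_elem (p + q)"
proof -
  from assms obtain t u where *: "t > 0" "u > 0" "norm (t *\<^sub>R 1 - p) \<le> t" "norm (u *\<^sub>R 1 - q) \<le> u"
    by (auto simp: nonneg_elem_def)
  have "(t + u) *\<^sub>R 1 - (p + q) = (t *\<^sub>R 1 - p) + (u *\<^sub>R 1 - q)" by (simp add: scaleR_add_left)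
  then have "norm ((t + u) *\<^sub>R 1 - (p + q)) \<le> t + u"
    using norm_triangle_mono[OF *(3,4)] by (simp only:)
  then show ?thesis using * assms by (auto simp: nonneg_elem_def intro!: exI[of _ "t + u"])
qed

lemma nonneg_elem_0: "nonneg_elem 0"
  by (auto simp: nonneg_elem_def intro!: exI[of _ 1])

lemma nonneg_elem_sum: "(\<And>i. i \<in> A \<Longrightarrow> nonneg_elem (f i)) \<Longrightarrow> nonneg_elem (\<Sum>i\<in>A. f i)"
  by (induction A rule: infinite_finite_induct) (auto intro: nonneg_elem_add nonneg_elem_0)

lemma nonneg_elem_scaleR:
  assumes "nonneg_elem p" "r \<ge> 0"
  shows "nonneg_elem (r *\<^sub>R p)"
proof (cases "r = 0")
  case False
  from assms obtain t where t: "t > 0" "norm (t *\<^sub>R 1 - p) \<le> t"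
    by (auto simp: nonneg_elem_def)
  have "(r * t) *\<^sub>R 1 - r *\<^sub>R p = r *\<^sub>R (t *\<^sub>R 1 - p)" by (simp add: scaleR_diff_right)
  then have "norm ((r * t) *\<^sub>R 1 - r *\<^sub>R p) \<le> r * t" using t assms by (simp add: mult_left_mono)
  then show ?thesis using t assms False by (auto simp: nonneg_elem_def intro!: exI[of _ "r * t"])
qed (simp add: nonneg_elem_0)

text \<open>The witness is \<open>M\<close> itself. A witness must be positive, so
  \<open>M = 0\<close>, which forces x = 0, is treated apart.\<close>

lemma nonneg_elem_diff:
  assumes "x \<in> self_adjoints" "norm x \<le> M"
  shows "nonneg_elem (M *\<^sub>R 1 - x)"
proof (cases "M = 0")
  case False
  then have "M > 0" using assms norm_ge_zero[of x] by linarith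
  then show ?thesis using assms by (auto simp: nonneg_elem_def intro!: exI[of _ M])
qed (use assms nonneg_elem_0 in auto)

text \<open>With u = t + \<delta>, the element p + \<delta> equals u (1 - x) for x = (t - p) / u.
  The shift by \<delta> makes the norm of x strictly less than 1, as the binomial series
  requires.\<close>

lemma nonneg_elem_sqrt:
  assumes "nonneg_elem p" "\<delta> > 0"
  obtains q where "q \<in> self_adjoints" "q\<^sup>2 = p + \<delta> *\<^sub>R 1" "\<And>y. p * y = y * p \<Longrightarrow> q * y = y * q"
proof -
  from assms obtain t where t: "t > 0" "norm (t *\<^sub>R 1 - p) \<le> t" and p: "p \<in> self_adjoints"
    by (auto simp: nonneg_elem_def)
  define u where "u = t + \<delta>"
  define x where "x = (1 / u) *\<^sub>R (t *\<^sub>R 1 - p)"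
  have u: "u > 0" "t < u" using t assms by (auto simp: u_def)
  have "x \<in> self_adjoints" using p by (simp add: x_def)
  moreover have "norm x < 1" using t u by (simp add: x_def)
  ultimately obtain q where q: "q \<in> self_adjoints" "q\<^sup>2 = 1 - x"
      "\<And>y. x * y = y * x \<Longrightarrow> q * y = y * q"
    using sqrt_one_minus by blast
  show thesis
  proof
    show "sqrt u *\<^sub>R q \<in> self_adjoints" using q by simp
    have "(sqrt u *\<^sub>R q)\<^sup>2 = u *\<^sub>R (1 - x)"
      using u by (simp add: scaleR_power q)
    also have "\<dots> = p + \<delta> *\<^sub>R 1"
      using u by (simp add: x_def u_def scaleR_diff_right scaleR_add_left)
    finally show "(sqrt u *\<^sub>R q)\<^sup>2 = p + \<delta> *\<^sub>R 1" .
    fix y assume "p * y = y * p"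
    then have "x * y = y * x" by (simp add: x_def algebra_simps)
    then show "(sqrt u *\<^sub>R q) * y = y * (sqrt u *\<^sub>R q)" using q(3) by simp
  qed
qed

section \<open>Squares are nonnegative, and a sum of squares dominates each term in norm\<close>

text \<open>For commuting self-adjoint \<open>a\<close>, \<open>b\<close>, the element \<open>u = a + \<i>b\<close> satisfies
  \<open>u\<^sup>* u = a\<^sup>2 + b\<^sup>2\<close>, and \<open>a\<close> is the real part of \<open>u\<close>.\<close>

lemma norm_square_le_of_commuting_squares:
  fixes a b :: "'a::cstar_algebra_1"
  assumes sa: "a \<in> self_adjoints" "b \<in> self_adjoints" and comm: "a * b = b * a"
    and sum: "a\<^sup>2 + b\<^sup>2 = M *\<^sub>R 1" and "M \<ge> 0"
  shows "(norm a)\<^sup>2 \<le> M"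
proof -
  have scaleC_m1: "scaleC (-1) x = - x" for x :: 'a
    using scaleR_eq_scaleC[of "-1" x] by simp
  have scaleC_minus: "scaleC (-c) x = - scaleC c x" for x :: 'a and c
    using scaleC_scaleC[of "-1" c x] by (simp add: scaleC_m1)
  have scaleC_diff: "scaleC c (x - y) = scaleC c x - scaleC c y" for x y :: 'a and c
    using scaleC_add_right[of c "x - y" y] by (simp add: algebra_simps)
  define u where "u = a + scaleC \<i> b"
  have star_u: "star u = a - scaleC \<i> b"
    using sa by (simp add: u_def star_add star_scaleC self_adjoints_def scaleC_minus)
  have "star u * u = M *\<^sub>R 1"
    unfolding star_u sum[symmetric]
    by (simp add: u_def algebra_simps mult_scaleC_left mult_scaleC_right scaleC_scaleC scaleC_m1 scaleC_diff
        comm power2_eq_square)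
  then have "(norm u)\<^sup>2 = \<bar>M\<bar>" using cstar_identity[of u] by simp
  \<comment> \<open>Passing to the real part does not increase the norm, because \<open>u\<close>
    and \<open>star u\<close> have the same norm.\<close>
  moreover have "2 *\<^sub>R a = u + star u"
    unfolding star_u by (simp add: u_def scaleR_2)
  then have "2 * norm a \<le> 2 * norm u"
    using norm_triangle_ineq[of u "star u"] by (metis norm_scaleR abs_numeral norm_star mult_2)
  ultimately show ?thesis by (metis \<open>M \<ge> 0\<close> abs_of_nonneg mult_le_cancel_left_pos norm_ge_zero power_mono zero_less_numeral)
qed

text \<open>Scale \<open>a\<close> to \<open>b\<close> of norm less than 1 and let q be the root of
  1 - b^2. Then q + ib is unitary, so q has norm at most 1, and so has 1 - b^2 = q^2. Hence t = 1
  witnesses that b^2 is nonnegative.\<close>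

lemma nonneg_elem_square:
  assumes "a \<in> self_adjoints"
  shows "nonneg_elem (a\<^sup>2)"
proof -
  define r where "r = norm a + 1"
  define b where "b = (1 / r) *\<^sub>R a"
  have r: "r > 0" by (simp add: r_def add_nonneg_pos)
  have b: "b \<in> self_adjoints" using assms by (simp add: b_def)
  have "norm b < 1" using r by (simp add: b_def r_def)
  then have "norm (b\<^sup>2) < 1"
    using b by (simp add: norm_square_self_adjoint power_less_one_iff)
  then obtain q where q: "q \<in> self_adjoints" "q\<^sup>2 = 1 - b\<^sup>2" "\<And>y. b\<^sup>2 * y = y * b\<^sup>2 \<Longrightarrow> q * y = y * q"
    using sqrt_one_minus[of "b\<^sup>2"] b by auto
  have "(norm q)\<^sup>2 \<le> 1"
    using q b by (intro norm_square_le_of_commuting_squares[of q b]) (auto simp: power_commutes)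
  then have "norm (1 - b\<^sup>2) \<le> 1"
    using norm_square_self_adjoint[OF q(1)] q(2) by simp
  then have "nonneg_elem (b\<^sup>2)"
    using b by (auto simp: nonneg_elem_def intro!: exI[of _ 1])
  then have "nonneg_elem (r\<^sup>2 *\<^sub>R b\<^sup>2)" by (rule nonneg_elem_scaleR) simp
  moreover have "r\<^sup>2 *\<^sub>R b\<^sup>2 = a\<^sup>2" using r by (simp add: b_def power_divide scaleR_power)
  ultimately show ?thesis by simp
qed

text \<open>With S the sum, \<open>norm S\<close> - (f k)^2 is nonnegative, being
  \<open>norm S\<close> - S plus the remaining squares. After adding e it has a root
  \<open>c\<close> commuting with \<open>f k\<close>, so \<open>f k\<close> is the real part of a
  multiple of a unitary, with squared norm \<open>norm S + e\<close>. Then e tends to 0.\<close>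

lemma norm_square_le_norm_sum_squares:
  fixes f :: "'i \<Rightarrow> 'a::cstar_algebra_1"
  assumes "finite A" "k \<in> A" and sa: "\<And>i. i \<in> A \<Longrightarrow> f i \<in> self_adjoints"
  shows "(norm (f k))\<^sup>2 \<le> norm (\<Sum>i\<in>A. (f i)\<^sup>2)"
proof (rule field_le_epsilon)
  fix e :: real assume "e > 0"
  define S where "S = (\<Sum>i\<in>A. (f i)\<^sup>2)"
  define p where "p = norm S *\<^sub>R 1 - (f k)\<^sup>2"
  have "S \<in> self_adjoints" unfolding S_def using sa by auto
  then have "nonneg_elem ((norm S *\<^sub>R 1 - S) + (\<Sum>i\<in>A - {k}. (f i)\<^sup>2))"
    using sa by (intro nonneg_elem_add nonneg_elem_diff nonneg_elem_sum nonneg_elem_square) auto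
  moreover have "S = (f k)\<^sup>2 + (\<Sum>i\<in>A - {k}. (f i)\<^sup>2)"
    unfolding S_def using assms by (simp add: sum.remove)
  ultimately have "nonneg_elem p" by (simp add: p_def algebra_simps)
  from nonneg_elem_sqrt[OF this \<open>e > 0\<close>] obtain c where c: "c \<in> self_adjoints"
    "c\<^sup>2 = p + e *\<^sub>R 1" "\<And>y. p * y = y * p \<Longrightarrow> c * y = y * c" by blast
  have "c * f k = f k * c"
    by (rule c(3)) (simp add: p_def algebra_simps power_commutes)
  moreover have "(f k)\<^sup>2 + c\<^sup>2 = (norm S + e) *\<^sub>R 1"
    by (simp add: c(2) p_def scaleR_add_left)
  ultimately show "(norm (f k))\<^sup>2 \<le> norm S + e"
    using sa assms c(1) \<open>e > 0\<close> by (intro norm_square_le_of_commuting_squares[of _ c]) auto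
qed

section \<open>Invertible elements: Neumann series and openness\<close>

lemma invertible_elem_one_minus:
  fixes x :: "'a::{real_normed_algebra_1,banach}"
  assumes "norm x < 1"
  shows "invertible_elem (1 - x)"
proof -
  have "summable (\<lambda>n. norm (x ^ n))"
    by (rule summable_comparison_test[OF _ summable_geometric[of "norm x"]])
      (use assms in \<open>auto simp: norm_power_ineq\<close>)
  then have s: "summable (\<lambda>n. x ^ n)" by (rule summable_norm_cancel)
  define z where "z = (\<Sum>n. x ^ n)"
  have "(\<Sum>n. x ^ Suc n) = z - 1"
    using suminf_split_head[OF s] by (simp add: z_def)
  moreover have "x * z = (\<Sum>n. x ^ Suc n)" "z * x = (\<Sum>n. x ^ Suc n)"
    unfolding z_def suminf_mult[OF s, symmetric] suminf_mult2[OF s]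
    by (simp_all add: power_commutes)
  ultimately have "(1 - x) * z = 1 \<and> z * (1 - x) = 1" by (simp add: algebra_simps)
  then show ?thesis unfolding invertible_elem_def by blast
qed

lemma invertible_elem_mult:
  assumes "invertible_elem x" "invertible_elem y"
  shows "invertible_elem (x * y)"
proof -
  from assms obtain u v where "x * u = 1" "u * x = 1" "y * v = 1" "v * y = 1"
    by (auto simp: invertible_elem_def)
  then have "(x * y) * (v * u) = 1 \<and> (v * u) * (x * y) = 1"
    by (metis mult.assoc mult.left_neutral)
  then show ?thesis unfolding invertible_elem_def by blast
qed

lemma invertible_elem_scaleR:
  fixes x :: "'a::real_algebra_1"
  assumes "invertible_elem x" "r \<noteq> 0"
  shows "invertible_elem (r *\<^sub>R x)"
proof -
  from assms obtain z where "x * z = 1" "z * x = 1" by (auto simp: invertible_elem_def)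
  then show ?thesis
    using assms(2) unfolding invertible_elem_def by (intro exI[of _ "inverse r *\<^sub>R z"]) simp
qed

lemma open_invertible_elem: "open {x::'a::{real_normed_algebra_1,banach}. invertible_elem x}"
proof (rule openI, clarify)
  fix x :: 'a assume x: "invertible_elem x"
  then obtain z where z: "x * z = 1" "z * x = 1" by (auto simp: invertible_elem_def)
  have pos: "norm z + 1 > 0" by (simp add: add_nonneg_pos)
  have "invertible_elem y" if "dist x y < 1 / (norm z + 1)" for y
  proof -
    \<comment> \<open>Since z inverts x, y = x (1 - z (x - y)); the second factor is invertible once
      z (x - y) has norm less than 1.\<close>
    have "norm (z * (x - y)) \<le> norm z * norm (x - y)" by (rule norm_mult_ineq)
    also have "\<dots> \<le> (norm z + 1) * norm (x - y)" by (simp add: mult_right_mono)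
    also have "\<dots> < 1" using that pos by (simp add: dist_norm field_simps)
    finally have "invertible_elem (x * (1 - z * (x - y)))"
      using x by (intro invertible_elem_mult invertible_elem_one_minus)
    moreover have "x * (1 - z * (x - y)) = y"
      using z by (simp add: right_diff_distrib flip: mult.assoc)
    ultimately show ?thesis by simp
  qed
  then show "\<exists>T>0. ball x T \<subseteq> {x. invertible_elem x}"
    using pos by (intro exI[of _ "1 / (norm z + 1)"]) auto
qed

section \<open>Lower bounds for nonnegative elements, and rescaled sums of squares\<close>

lemma invertible_elem_nonneg_add:
  assumes "nonneg_elem p" "\<delta> > 0"
  shows "invertible_elem (p + \<delta> *\<^sub>R 1)"
proof -
  from assms obtain t where t: "t > 0" "norm (t *\<^sub>R 1 - p) \<le> t"
    by (auto simp: nonneg_elem_def)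
  have "norm ((1 / (t + \<delta>)) *\<^sub>R (t *\<^sub>R 1 - p)) < 1" using t assms(2) by simp
  then have "invertible_elem ((t + \<delta>) *\<^sub>R (1 - (1 / (t + \<delta>)) *\<^sub>R (t *\<^sub>R 1 - p)))"
    using t assms(2) by (intro invertible_elem_scaleR invertible_elem_one_minus) auto
  also have "(t + \<delta>) *\<^sub>R (1 - (1 / (t + \<delta>)) *\<^sub>R (t *\<^sub>R 1 - p)) = p + \<delta> *\<^sub>R 1"
    using t assms(2) by (simp add: scaleR_diff_right scaleR_add_left)
  finally show ?thesis .
qed

text \<open>If the inverse z is at most K, multiplying K - z by s suggests K s - 1 >= 0. The product
  of commuting nonnegative elements is handled as the square of a product of roots; since roots are
  available only after a positive shift, s is replaced by s + \<delta>, and the error is absorbed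
  into 1/2.\<close>

lemma nonneg_invertible_bounded_below:
  fixes s :: "'a::cstar_algebra_1"
  assumes s: "nonneg_elem s" and "invertible_elem s"
  obtains \<eta> where "\<eta> > 0" "nonneg_elem (s - \<eta> *\<^sub>R 1)"
proof -
  from assms obtain z where z: "s * z = 1" "z * s = 1" by (auto simp: invertible_elem_def)
  have "star z * s = 1"
    using s z star_mult[of s z] by (simp add: nonneg_elem_def self_adjoints_def)
  then have "star z = z" using z by (metis mult.assoc mult.left_neutral mult.right_neutral)
  then have z_sa: "z \<in> self_adjoints" by (simp add: self_adjoints_def)
  define K where "K = norm z + 1"
  \<comment> \<open>Chosen so that the error terms \<delta> K and \<delta> \<open>norm z\<close> add
    up to 1/2.\<close>
  define \<delta> where "\<delta> = 1 / (2 * (K + norm z))"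
  have K: "K > 0" "K + norm z > 0" by (auto simp: K_def add_nonneg_pos)
  then have "\<delta> > 0" "\<delta> * (K + norm z) = 1/2"
    unfolding \<delta>_def by simp_all
  then have \<delta>: "\<delta> > 0" "\<delta> * K + \<delta> * norm z = 1/2"
    by (simp_all only: distrib_left)
  obtain r where r: "r \<in> self_adjoints" "r\<^sup>2 = (norm z *\<^sub>R 1 - z) + 1 *\<^sub>R 1"
      "\<And>y. (norm z *\<^sub>R 1 - z) * y = y * (norm z *\<^sub>R 1 - z) \<Longrightarrow> r * y = y * r"
    using nonneg_elem_sqrt[OF nonneg_elem_diff[OF z_sa order_refl] zero_less_one] by blast
  have r2: "r\<^sup>2 = K *\<^sub>R 1 - z" by (simp add: r(2) K_def scaleR_add_left)
  obtain q where q: "q \<in> self_adjoints" "q\<^sup>2 = s + \<delta> *\<^sub>R 1" "\<And>y. s * y = y * s \<Longrightarrow> q * y = y * q"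
    using nonneg_elem_sqrt[OF s \<delta>(1)] by blast
  \<comment> \<open>Commutation passes from z to r and then, through the root q of s + \<delta>, to
    the pair q, r.\<close>
  have "r * s = s * r" by (rule r(3)) (simp add: algebra_simps z)
  then have comm: "q * r = r * q" by (intro q(3)) simp
  have "r * q \<in> self_adjoints" using r(1) q(1) comm by (simp add: self_adjoints_mult)
  then have "nonneg_elem ((r * q)\<^sup>2)" by (rule nonneg_elem_square)
  also have "(r * q)\<^sup>2 = r\<^sup>2 * q\<^sup>2"
    using comm by (simp add: power2_eq_square) (metis mult.assoc)
  also have "\<dots> = K *\<^sub>R s + (\<delta> * K) *\<^sub>R 1 - 1 - \<delta> *\<^sub>R z"
    by (simp add: r2 q(2) algebra_simps z)
  finally have "nonneg_elem (K *\<^sub>R s + (\<delta> * K) *\<^sub>R 1 - 1 - \<delta> *\<^sub>R z)" .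
  \<comment> \<open>Adding \<delta> (\<open>norm z\<close> + z) cancels the term -\<delta> z;
    writing z as -(0 - z) fits \<open>nonneg_elem_diff\<close>.\<close>
  moreover have "nonneg_elem (\<delta> *\<^sub>R (norm z *\<^sub>R 1 - (0 - z)))"
    using \<delta>(1) by (intro nonneg_elem_scaleR nonneg_elem_diff self_adjoints_intros z_sa) simp_all
  ultimately have "nonneg_elem ((K *\<^sub>R s + (\<delta> * K) *\<^sub>R 1 - 1 - \<delta> *\<^sub>R z)
      + \<delta> *\<^sub>R (norm z *\<^sub>R 1 - (0 - z)))"
    by (rule nonneg_elem_add)
  also have "\<dots> = K *\<^sub>R s + (\<delta> * K + \<delta> * norm z) *\<^sub>R 1 - 1"
    by (simp add: algebra_simps)
  also have "\<dots> = K *\<^sub>R s - (1/2) *\<^sub>R 1"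
    unfolding \<delta>(2) using scaleR_add_left[of "1/2" "1/2" "1::'a"] by (simp add: algebra_simps)
  finally have "nonneg_elem ((1 / K) *\<^sub>R (K *\<^sub>R s - (1/2) *\<^sub>R 1))"
    using K by (intro nonneg_elem_scaleR) auto
  then have "nonneg_elem (s - (1 / (K * 2)) *\<^sub>R 1)"
    using K by (simp add: scaleR_diff_right)
  then show thesis using that[of "1 / (K * 2)"] K by simp
qed

text \<open>Let m > 0 be a lower bound of the (c i)^2 and \<eta> > 0 one of s. The new sum is a
  combination of squares with weights (c i)^2 - m >= 0, plus m (s - \<eta>), plus the positive
  scalar m \<eta>.\<close>

lemma invertible_elem_sum_squares_scaleR:
  fixes f :: "'i \<Rightarrow> 'a::cstar_algebra_1"
  assumes "finite A" and sa: "\<And>i. i \<in> A \<Longrightarrow> f i \<in> self_adjoints"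
    and c: "\<And>i. i \<in> A \<Longrightarrow> c i \<noteq> 0"
    and inv: "invertible_elem (\<Sum>i\<in>A. (f i)\<^sup>2)"
  shows "invertible_elem (\<Sum>i\<in>A. (c i *\<^sub>R f i)\<^sup>2)"
proof -
  define s where "s = (\<Sum>i\<in>A. (f i)\<^sup>2)"
  \<comment> \<open>Inserting 1 keeps the minimum meaningful when \<open>A\<close> is empty.\<close>
  define m where "m = Min (insert 1 ((\<lambda>i. (c i)\<^sup>2) ` A))"
  have m: "m > 0" "\<And>i. i \<in> A \<Longrightarrow> m \<le> (c i)\<^sup>2"
    using \<open>finite A\<close> c by (auto simp: m_def)
  have "nonneg_elem s"
    unfolding s_def using sa by (intro nonneg_elem_sum nonneg_elem_square)
  then obtain \<eta> where \<eta>: "\<eta> > 0" "nonneg_elem (s - \<eta> *\<^sub>R 1)"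
    using inv nonneg_invertible_bounded_below unfolding s_def by blast
  have "nonneg_elem ((\<Sum>i\<in>A. ((c i)\<^sup>2 - m) *\<^sub>R (f i)\<^sup>2) + m *\<^sub>R (s - \<eta> *\<^sub>R 1))"
    using m sa \<eta> by (intro nonneg_elem_add nonneg_elem_sum nonneg_elem_scaleR nonneg_elem_square) auto
  then have "invertible_elem ((\<Sum>i\<in>A. ((c i)\<^sup>2 - m) *\<^sub>R (f i)\<^sup>2) + m *\<^sub>R (s - \<eta> *\<^sub>R 1) + (m * \<eta>) *\<^sub>R 1)"
    using m \<eta> by (intro invertible_elem_nonneg_add) auto
  also have "(\<Sum>i\<in>A. ((c i)\<^sup>2 - m) *\<^sub>R (f i)\<^sup>2) + m *\<^sub>R (s - \<eta> *\<^sub>R 1) + (m * \<eta>) *\<^sub>R 1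
      = (\<Sum>i\<in>A. (c i *\<^sub>R f i)\<^sup>2)"
    by (simp add: s_def scaleR_diff_left scaleR_diff_right sum_subtractf scaleR_sum_right scaleR_power)
  finally show ?thesis .
qed

section \<open>Baire's theorem in the space of sequences\<close>

lemma dist_fun_le:
  fixes f g :: "'i::countable \<Rightarrow> 'a::metric_space"
  assumes "\<And>i. dist (f i) (g i) \<le> e"
  shows "dist f g \<le> 2 * e"
proof -
  \<comment> \<open>The product metric gives the n-th coordinate the weight (1/2)^n, and these
    weights sum to 2.\<close>
  have geo: "(\<lambda>n. (1/2)^n * e) sums (2 * e)"
    using sums_mult2[OF geometric_sums[of "1/2::real"], of e] by simp
  have "dist f g \<le> (\<Sum>n. (1/2)^n * e)"
    unfolding dist_fun_def
  proof (rule suminf_le)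
    show "(1/2)^n * min (dist (f (from_nat n)) (g (from_nat n))) 1 \<le> (1/2)^n * e" for n
      using assms[of "from_nat n"] by (intro mult_left_mono) auto
    show "summable (\<lambda>n. (1/2)^n * min (dist (f (from_nat n)) (g (from_nat n))) 1)"
      by (rule summable_comparison_test'[of "\<lambda>n. (1/2)^n"])
        (auto simp: summable_geometric_iff)
  qed (use geo in \<open>simp add: sums_iff\<close>)
  then show ?thesis using geo by (simp add: sums_iff)
qed

text \<open>A closed subset of a complete space is complete in the restricted metric, so the Baire
  theorem for abstract metrics applies to it; the intersection is dense in the nonempty
  \<open>S\<close>, hence meets it.\<close>

lemma Baire_complete_space:
  fixes S :: "'a::complete_space set"
  assumes "closed S" "countable \<G>" "S \<noteq> {}"
    and "\<And>T. T \<in> \<G> \<Longrightarrow> openin (top_of_set S) T \<and> S \<subseteq> closure T"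
  shows "S \<inter> \<Inter>\<G> \<noteq> {}"
proof
  assume empty: "S \<inter> \<Inter>\<G> = {}"
  interpret Submetric UNIV dist S by unfold_locales auto
  have top: "sub.mtopology = top_of_set S"
    by (simp add: mtopology_submetric)
  have "sub.mcomplete"
    using closedin_mcomplete_imp_mcomplete assms(1) complete_UNIV by simp
  moreover have "sub.mtopology closure_of T = S" if "T \<in> \<G>" for T
    using assms(4)[OF that] openin_subset[of "top_of_set S" T]
    by (auto simp: top closure_of_subtopology Int_absorb1)
  ultimately have "sub.mtopology closure_of \<Inter>\<G> = S"
    using assms by (intro sub.metric_Baire_category) (auto simp: top)
  then have "S = sub.mtopology closure_of (S \<inter> \<Inter>\<G>)"
    by (metis closure_of_restrict sub.topspace_mtopology)
  with empty assms(3) show False by simp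
qed

lemma simultaneous_perturbation:
  fixes x :: "'i::countable \<Rightarrow> 'a::cstar_algebra_1"
  assumes "countable \<D>" and fin: "\<And>D. D \<in> \<D> \<Longrightarrow> finite D"
    and x: "\<And>i. x i \<in> self_adjoints" and \<epsilon>: "\<And>i. \<epsilon> i > 0"
    and dense: "\<And>D y e. D \<in> \<D> \<Longrightarrow> (\<And>i. y i \<in> self_adjoints) \<Longrightarrow> e > 0 \<Longrightarrow>
      \<exists>w :: 'i \<Rightarrow> 'a. (\<forall>i\<in>D. w i \<in> self_adjoints \<and> norm (y i - w i) < e) \<and>
        invertible_elem (\<Sum>i\<in>D. (w i)\<^sup>2)"
  shows "\<exists>y. (\<forall>i. y i \<in> self_adjoints \<and> norm (x i - y i) < \<epsilon> i) \<and>
    (\<forall>D\<in>\<D>. invertible_elem (\<Sum>i\<in>D. (y i)\<^sup>2))"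
proof -
  \<comment> \<open>The closed box has half the allowed radii, so its points satisfy the strict
    bounds required at the end.\<close>
  define S where "S = {y. \<forall>i. y i \<in> self_adjoints \<and> norm (x i - y i) \<le> \<epsilon> i / 2}"
  define U where "U D = {y :: 'i \<Rightarrow> 'a. invertible_elem (\<Sum>i\<in>D. (y i)\<^sup>2)}" for D
  have "closed S"
  proof -
    have "S = (\<Inter>i. (\<lambda>y. y i) -` (self_adjoints \<inter> cball (x i) (\<epsilon> i / 2)))"
      by (auto simp: S_def dist_norm)
    then show ?thesis
      by (auto intro!: closed_INT closed_vimage closed_Int closed_self_adjoints)
  qed
  have "open (U D)" for D
  proof -
    have "open ((\<lambda>y :: 'i \<Rightarrow> 'a. \<Sum>i\<in>D. (y i)\<^sup>2) -` {z. invertible_elem z})"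
      by (intro open_vimage open_invertible_elem continuous_intros) auto
    then show ?thesis by (simp add: U_def vimage_def)
  qed
  moreover have "S \<subseteq> closure (S \<inter> U D)" if D: "D \<in> \<D>" for D
  proof
    fix y assume "y \<in> S"
    then have y: "y i \<in> self_adjoints" "norm (x i - y i) \<le> \<epsilon> i / 2" for i by (auto simp: S_def)
    show "y \<in> closure (S \<inter> U D)" unfolding closure_approachable
    proof clarify
      fix e :: real assume "e > 0"
      \<comment> \<open>These bound the radii over \<open>D\<close> from above and below; inserting
        1 covers an empty \<open>D\<close>.\<close>
      define M where "M = Max (insert 1 (\<epsilon> ` D))"
      define m where "m = Min (insert 1 (\<epsilon> ` D))"
      have M: "M > 0" "\<And>i. i \<in> D \<Longrightarrow> \<epsilon> i \<le> M" and m: "m > 0" "\<And>i. i \<in> D \<Longrightarrow> m \<le> \<epsilon> i"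
        using fin[OF D] \<epsilon> by (auto simp: M_def m_def Max_gr_iff)
      define t where "t = min 1 (e / (4 * M))"
      have t: "0 < t" "t \<le> 1" "t * M \<le> e / 4"
        using M(1) \<open>e > 0\<close> by (auto simp: t_def min_def field_simps)
      \<comment> \<open>Since y may lie on the boundary of the box, it is first moved towards the
        centre x by the fraction t. This frees a margin t (\<epsilon> i) / 2 in each coordinate of
        \<open>D\<close> for the perturbation w.\<close>
      define v where "v i = y i + t *\<^sub>R (x i - y i)" for i
      have "v i \<in> self_adjoints" for i using x y by (simp add: v_def)
      \<comment> \<open>The bound e / 8 keeps w near y; the bound t m / 2 keeps it inside the
        box.\<close>
      moreover have "min (e / 8) (t * m / 2) > 0" using \<open>e > 0\<close> t m by simp
      ultimately obtain w where w: "\<And>i. i \<in> D \<Longrightarrow> w i \<in> self_adjoints"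
        "\<And>i. i \<in> D \<Longrightarrow> norm (v i - w i) < min (e / 8) (t * m / 2)" "invertible_elem (\<Sum>i\<in>D. (w i)\<^sup>2)"
        using dense[OF D, of v "min (e / 8) (t * m / 2)"] by blast
      define y' where "y' i = (if i \<in> D then w i else y i)" for i
      have "norm (x i - w i) \<le> \<epsilon> i / 2" if i: "i \<in> D" for i
      proof -
        have eq: "x i - w i = (1 - t) *\<^sub>R (x i - y i) + (v i - w i)"
          by (simp add: v_def algebra_simps)
        have "norm (x i - w i) \<le> (1 - t) * norm (x i - y i) + norm (v i - w i)"
          unfolding eq using norm_triangle_ineq[of "(1 - t) *\<^sub>R (x i - y i)" "v i - w i"] t by simp
        also have "\<dots> \<le> (1 - t) * (\<epsilon> i / 2) + t * \<epsilon> i / 2"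
        proof (intro add_mono mult_left_mono)
          have "norm (v i - w i) < t * m / 2" using w(2)[OF i] by simp
          also have "\<dots> \<le> t * \<epsilon> i / 2" using m(2)[OF i] t by (simp add: mult_left_mono)
          finally show "norm (v i - w i) \<le> t * \<epsilon> i / 2" by simp
        qed (use y t in auto)
        also have "\<dots> = \<epsilon> i / 2" by (simp add: field_simps)
        finally show ?thesis .
      qed
      then have "y' \<in> S \<inter> U D"
        using w y by (auto simp: S_def U_def y'_def)
      \<comment> \<open>Moving to v costs at most t M / 2 <= e / 8 and moving on to w at most e / 8;
        \<open>dist_fun_le\<close> doubles the total to e / 2.\<close>
      moreover have "dist (y' i) (y i) \<le> e / 4" for i
      proof (cases "i \<in> D")
        case True
        have "norm (w i - y i) \<le> norm (w i - v i) + norm (v i - y i)"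
          using norm_triangle_ineq[of "w i - v i" "v i - y i"] by simp
        also have "norm (v i - y i) = t * norm (x i - y i)" using t by (simp add: v_def)
        also have "\<dots> \<le> t * (M / 2)"
          using t M(2)[OF True] y(2)[of i] by (intro mult_left_mono) auto
        finally show ?thesis
          using w(2)[OF True] t True by (simp add: y'_def dist_norm norm_minus_commute)
      qed (use \<open>e > 0\<close> in \<open>simp add: y'_def\<close>)
      then have "dist y' y \<le> 2 * (e / 4)" by (rule dist_fun_le)
      ultimately show "\<exists>y'\<in>S \<inter> U D. dist y' y < e" using \<open>e > 0\<close> by (intro bexI[of _ y']) auto
    qed
  qed
  moreover have "x \<in> S" using x \<epsilon> by (simp add: S_def less_imp_le)
  ultimately have "S \<inter> \<Inter>((\<lambda>D. S \<inter> U D) ` \<D>) \<noteq> {}"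
    using \<open>closed S\<close> \<open>countable \<D>\<close> by (intro Baire_complete_space) auto
  then obtain y where y: "y \<in> S" "\<And>D. D \<in> \<D> \<Longrightarrow> y \<in> U D" by blast
  then have "norm (x i - y i) < \<epsilon> i" for i
    using \<epsilon>[of i] by (auto simp: S_def intro: le_less_trans[of _ "\<epsilon> i / 2"])
  then show ?thesis using y by (intro exI[of _ y]) (auto simp: S_def U_def)
qed

section \<open>The cycle of implications between the five conditions\<close>

theorem proposition1p1:
  fixes n :: nat
  shows
    "(real_rank_le TYPE('a::cstar_algebra_1) n \<longleftrightarrow>
        (\<forall>x :: nat \<Rightarrow> 'a. \<forall>\<epsilon>::real.
          (\<forall>k\<in>{1..n+1}. x k \<in> self_adjoints) \<and> \<epsilon> > 0 \<longrightarrow>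
          (\<exists>y :: nat \<Rightarrow> 'a. (\<forall>k\<in>{1..n+1}. y k \<in> self_adjoints) \<and>
            invertible_elem (\<Sum>k=1..n+1. (y k)\<^sup>2) \<and>
            (\<forall>k\<in>{1..n+1}. norm (x k - y k) < \<epsilon>)))) \<and>
     (real_rank_le TYPE('a) n \<longleftrightarrow>
        (\<forall>x :: nat \<Rightarrow> 'a. \<forall>\<epsilon> :: nat \<Rightarrow> real.
          (\<forall>i\<ge>1. x i \<in> self_adjoints) \<and> (\<forall>i\<ge>1. \<epsilon> i > 0) \<longrightarrow>
          (\<exists>y :: nat \<Rightarrow> 'a. (\<forall>i\<ge>1. y i \<in> self_adjoints) \<and>
            (\<forall>i\<ge>1. norm (x i - y i) < \<epsilon> i) \<and>
            (\<forall>D \<subseteq> {1..}. card D = n + 1 \<longrightarrow> invertible_elem (\<Sum>i\<in>D. (y i)\<^sup>2))))) \<and>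
     (real_rank_le TYPE('a) n \<longleftrightarrow>
        (\<forall>x :: nat \<Rightarrow> 'a. \<forall>\<epsilon>::real.
          (\<forall>i\<ge>1. x i \<in> self_adjoints) \<and> \<epsilon> > 0 \<longrightarrow>
          (\<exists>y :: nat \<Rightarrow> 'a. (\<forall>i\<ge>1. y i \<in> self_adjoints) \<and>
            (\<forall>i\<ge>1. norm (x i - y i) < \<epsilon>) \<and>
            (\<forall>D \<subseteq> {1..}. card D = n + 1 \<longrightarrow> invertible_elem (\<Sum>i\<in>D. (y i)\<^sup>2))))) \<and>
     (real_rank_le TYPE('a) n \<longleftrightarrow>
        (\<forall>x :: nat \<Rightarrow> 'a. \<forall>\<epsilon>::real.
          (\<forall>i\<ge>1. x i \<in> self_adjoints) \<and> (\<forall>i\<ge>1. norm (x i) = 1) \<and> \<epsilon> > 0 \<longrightarrow>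
          (\<exists>y :: nat \<Rightarrow> 'a. (\<forall>i\<ge>1. y i \<in> self_adjoints) \<and>
            (\<forall>i\<ge>1. norm (x i - y i) < \<epsilon>) \<and>
            (\<forall>D \<subseteq> {1..}. card D = n + 1 \<longrightarrow> invertible_elem (\<Sum>i\<in>D. (y i)\<^sup>2)))))"
    (is "(?i \<longleftrightarrow> ?ii) \<and> (?i \<longleftrightarrow> ?iii) \<and> (?i \<longleftrightarrow> ?iv) \<and> (?i \<longleftrightarrow> ?v)")
proof -
  have i_ii: ?ii if i: ?i
  proof (intro allI impI, elim conjE)
    fix x :: "nat \<Rightarrow> 'a" and \<epsilon> :: real
    assume x: "\<forall>k\<in>{1..n+1}. x k \<in> self_adjoints" and "\<epsilon> > 0"
    \<comment> \<open>Real rank is applied with the squared tolerance, because the norm of the sum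
      controls the squares of the individual norms.\<close>
    then obtain y :: "nat \<Rightarrow> 'a" where y: "\<forall>k\<in>{1..n+1}. y k \<in> self_adjoints"
        "invertible_elem (\<Sum>k=1..n+1. (y k)\<^sup>2)" "norm (\<Sum>k=1..n+1. (x k - y k)\<^sup>2) < \<epsilon>\<^sup>2"
      using i[unfolded real_rank_le_def, THEN spec[of _ x], THEN spec[of _ "\<epsilon>\<^sup>2"]] by auto
    have "norm (x k - y k) < \<epsilon>" if "k \<in> {1..n+1}" for k
    proof (rule power_less_imp_less_base)
      have "(norm (x k - y k))\<^sup>2 \<le> norm (\<Sum>k=1..n+1. (x k - y k)\<^sup>2)"
        using x y(1) by (intro norm_square_le_norm_sum_squares that) auto
      then show "(norm (x k - y k))\<^sup>2 < \<epsilon>\<^sup>2" using y(3) by simp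
    qed (use \<open>\<epsilon> > 0\<close> in simp)
    then show "\<exists>y :: nat \<Rightarrow> 'a. (\<forall>k\<in>{1..n+1}. y k \<in> self_adjoints) \<and>
            invertible_elem (\<Sum>k=1..n+1. (y k)\<^sup>2) \<and>
            (\<forall>k\<in>{1..n+1}. norm (x k - y k) < \<epsilon>)"
      using y by blast
  qed
  have ii_i: ?i if ii: ?ii
    unfolding real_rank_le_def
  proof (intro allI impI, elim conjE)
    fix x :: "nat \<Rightarrow> 'a" and \<epsilon> :: real
    assume x: "\<forall>k\<in>{1..n+1}. x k \<in> self_adjoints" and "\<epsilon> > 0"
    \<comment> \<open>The n + 1 squares, each of norm less than \<delta>^2, then add up to less than
      \<epsilon>.\<close>
    define \<delta> where "\<delta> = sqrt (\<epsilon> / (n + 1))"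
    have \<delta>: "\<delta> > 0" using \<open>\<epsilon> > 0\<close> by (simp add: \<delta>_def)
    then obtain y :: "nat \<Rightarrow> 'a" where y: "\<forall>k\<in>{1..n+1}. y k \<in> self_adjoints"
        "invertible_elem (\<Sum>k=1..n+1. (y k)\<^sup>2)" "\<forall>k\<in>{1..n+1}. norm (x k - y k) < \<delta>"
      using x ii[THEN spec[of _ x], THEN spec[of _ \<delta>]] by blast
    have "norm ((x k - y k)\<^sup>2) < \<delta>\<^sup>2" if "k \<in> {1..n+1}" for k
      using x y that by (simp add: norm_square_self_adjoint power_strict_mono)
    then have "norm (\<Sum>k=1..n+1. (x k - y k)\<^sup>2) < (\<Sum>k=1..n+1. \<delta>\<^sup>2)"
      by (intro le_less_trans[OF norm_sum] sum_strict_mono) auto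
    also have "\<dots> = \<epsilon>" using \<open>\<epsilon> > 0\<close> by (simp add: \<delta>_def)
    finally show "\<exists>y :: nat \<Rightarrow> 'a. (\<forall>k\<in>{1..n+1}. y k \<in> self_adjoints) \<and>
        invertible_elem (\<Sum>k=1..n+1. (y k)\<^sup>2) \<and> norm (\<Sum>k=1..n+1. (x k - y k)\<^sup>2) < \<epsilon>"
      using y by blast
  qed
  have ii_iii: ?iii if ii: ?ii
  proof (intro allI impI, elim conjE)
    fix x :: "nat \<Rightarrow> 'a" and \<epsilon> :: "nat \<Rightarrow> real"
    assume x: "\<forall>i\<ge>1. x i \<in> self_adjoints" and \<epsilon>: "\<forall>i\<ge>1. \<epsilon> i > 0"
    \<comment> \<open>Sets containing 0 are included as well, so that all of \<open>nat\<close>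
      serves as index type; the positive cardinality makes each \<open>D\<close> finite.\<close>
    define \<D> where "\<D> = {D :: nat set. card D = n + 1}"
    have fin: "finite D" if "D \<in> \<D>" for D
      using that by (intro card_ge_0_finite) (simp add: \<D>_def)
    have "countable \<D>"
      using fin by (intro countable_subset[OF _ countable_Collect_finite]) auto
    have dense: "\<exists>w :: nat \<Rightarrow> 'a. (\<forall>i\<in>D. w i \<in> self_adjoints \<and> norm (y i - w i) < e) \<and>
        invertible_elem (\<Sum>i\<in>D. (w i)\<^sup>2)"
      if D: "D \<in> \<D>" and y: "\<And>i. y i \<in> self_adjoints" and "e > 0" for D e and y :: "nat \<Rightarrow> 'a"
    proof -
      \<comment> \<open>Condition (ii) speaks of the indices 1 to n + 1, so \<open>D\<close> is
        enumerated by \<open>h\<close> and the resulting tuple is carried back along its inverse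
        \<open>g\<close>.\<close>
      obtain h where h: "bij_betw h {1..n+1} D"
        using ex_bij_betw_nat_finite_1[OF fin[OF D]] D by (auto simp: \<D>_def)
      obtain w :: "nat \<Rightarrow> 'a" where w: "\<forall>k\<in>{1..n+1}. w k \<in> self_adjoints"
          "invertible_elem (\<Sum>k=1..n+1. (w k)\<^sup>2)" "\<forall>k\<in>{1..n+1}. norm (y (h k) - w k) < e"
        using ii[THEN spec[of _ "y \<circ> h"], THEN spec[of _ e]] y \<open>e > 0\<close> by auto
      define g where "g = the_inv_into {1..n+1} h"
      have bij_g: "bij_betw g D {1..n+1}" unfolding g_def using h by (rule bij_betw_the_inv_into)
      have g: "g i \<in> {1..n+1}" "h (g i) = i" if "i \<in> D" for i
        using bij_betwE[OF bij_g] f_the_inv_into_f_bij_betw[OF h] that by (auto simp: g_def)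
      from bij_g have "(\<Sum>i\<in>D. (w (g i))\<^sup>2) = (\<Sum>k=1..n+1. (w k)\<^sup>2)" by (rule sum.reindex_bij_betw)
      moreover have "w (g i) \<in> self_adjoints \<and> norm (y i - w (g i)) < e" if "i \<in> D" for i
        using w(1,3) g[OF that] by force
      ultimately show ?thesis using w(2) by (intro exI[of _ "w \<circ> g"]) auto
    qed
    \<comment> \<open>The assumptions say nothing about index 0, which receives the dummy centre 0
      and radius 1.\<close>
    have "\<exists>y. (\<forall>i. y i \<in> self_adjoints \<and> norm ((x(0 := 0)) i - y i) < (\<epsilon>(0 := 1)) i) \<and>
        (\<forall>D\<in>\<D>. invertible_elem (\<Sum>i\<in>D. (y i)\<^sup>2))"
      using \<open>countable \<D>\<close> fin _ _ dense
    proof (rule simultaneous_perturbation)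
      show "(x(0 := 0)) i \<in> self_adjoints" "(\<epsilon>(0 := 1)) i > 0" for i
        using x \<epsilon> by auto
    qed
    then obtain y where y: "\<forall>i. y i \<in> self_adjoints \<and> norm ((x(0 := 0)) i - y i) < (\<epsilon>(0 := 1)) i"
        "\<forall>D\<in>\<D>. invertible_elem (\<Sum>i\<in>D. (y i)\<^sup>2)"
      by blast
    show "\<exists>y :: nat \<Rightarrow> 'a. (\<forall>i\<ge>1. y i \<in> self_adjoints) \<and> (\<forall>i\<ge>1. norm (x i - y i) < \<epsilon> i) \<and>
        (\<forall>D \<subseteq> {1..}. card D = n + 1 \<longrightarrow> invertible_elem (\<Sum>i\<in>D. (y i)\<^sup>2))"
    proof (intro exI conjI allI impI)
      show "y i \<in> self_adjoints" for i using y(1) by simp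
      show "norm (x i - y i) < \<epsilon> i" if "i \<ge> 1" for i using y(1)[THEN spec[of _ i]] that by simp
      show "invertible_elem (\<Sum>i\<in>D. (y i)\<^sup>2)" if "card D = n + 1" for D
        using y(2) that by (simp add: \<D>_def)
    qed
  qed
  have iii_iv: ?iv if iii: ?iii
  proof (intro allI impI)
    fix x :: "nat \<Rightarrow> 'a" and \<epsilon> :: real
    assume "(\<forall>i\<ge>1. x i \<in> self_adjoints) \<and> \<epsilon> > 0"
    then show "\<exists>y :: nat \<Rightarrow> 'a. (\<forall>i\<ge>1. y i \<in> self_adjoints) \<and> (\<forall>i\<ge>1. norm (x i - y i) < \<epsilon>) \<and>
        (\<forall>D \<subseteq> {1..}. card D = n + 1 \<longrightarrow> invertible_elem (\<Sum>i\<in>D. (y i)\<^sup>2))"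
      by (intro iii[THEN spec[of _ x], THEN spec[of _ "\<lambda>_. \<epsilon>"], THEN mp]) simp
  qed
  have iv_v: ?v if iv: ?iv
  proof (intro allI impI)
    fix x :: "nat \<Rightarrow> 'a" and \<epsilon> :: real
    assume "(\<forall>i\<ge>1. x i \<in> self_adjoints) \<and> (\<forall>i\<ge>1. norm (x i) = 1) \<and> \<epsilon> > 0"
    then show "\<exists>y :: nat \<Rightarrow> 'a. (\<forall>i\<ge>1. y i \<in> self_adjoints) \<and> (\<forall>i\<ge>1. norm (x i - y i) < \<epsilon>) \<and>
        (\<forall>D \<subseteq> {1..}. card D = n + 1 \<longrightarrow> invertible_elem (\<Sum>i\<in>D. (y i)\<^sup>2))"
      by (intro iv[THEN spec[of _ x], THEN spec[of _ \<epsilon>], THEN mp]) simp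
  qed
  have v_ii: ?ii if v: ?v
  proof (intro allI impI, elim conjE)
    fix x :: "nat \<Rightarrow> 'a" and \<epsilon> :: real
    assume x: "\<forall>k\<in>{1..n+1}. x k \<in> self_adjoints" and "\<epsilon> > 0"
    \<comment> \<open>A zero entry cannot be normalised and is replaced by a scalar of norm
      \<epsilon> / 2. The same scalar extends the tuple to an infinite sequence of nonzero
      elements.\<close>
    define x' where "x' k = (if k \<in> {1..n+1} \<and> x k \<noteq> 0 then x k else (\<epsilon> / 2) *\<^sub>R 1)" for k
    have x': "x' k \<in> self_adjoints" "x' k \<noteq> 0" for k
      using x \<open>\<epsilon> > 0\<close> by (auto simp: x'_def)
    have near: "norm (x k - x' k) \<le> \<epsilon> / 2" if "k \<in> {1..n+1}" for k
      using that \<open>\<epsilon> > 0\<close> by (auto simp: x'_def)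
    define M where "M = Max ((\<lambda>k. norm (x' k)) ` {1..n+1})"
    have M: "norm (x' k) \<le> M" if "k \<in> {1..n+1}" for k
      unfolding M_def using that by (intro Max_ge) auto
    have "M > 0" by (rule less_le_trans[OF _ M[of 1]]) (simp_all add: x'(2))
    define z where "z k = (1 / norm (x' k)) *\<^sub>R x' k" for k
    have "z k \<in> self_adjoints" "norm (z k) = 1" for k using x' by (auto simp: z_def)
    \<comment> \<open>Scaling back multiplies the error by at most M, so this tolerance costs
      \<epsilon> / 2; the other half pays for replacing x by \<open>x'\<close>.\<close>
    then obtain y where y: "\<forall>k\<ge>1. y k \<in> self_adjoints" "\<forall>k\<ge>1. norm (z k - y k) < \<epsilon> / (2 * M)"
        "\<forall>D \<subseteq> {1..}. card D = n + 1 \<longrightarrow> invertible_elem (\<Sum>i\<in>D. (y i)\<^sup>2)"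
      using v[THEN spec[of _ z], THEN spec[of _ "\<epsilon> / (2 * M)"]] \<open>\<epsilon> > 0\<close> \<open>M > 0\<close> by auto
    have "invertible_elem (\<Sum>k=1..n+1. (norm (x' k) *\<^sub>R y k)\<^sup>2)"
    proof (rule invertible_elem_sum_squares_scaleR)
      show "invertible_elem (\<Sum>k=1..n+1. (y k)\<^sup>2)"
        by (rule y(3)[THEN spec, THEN mp, THEN mp]) auto
    qed (use x' y(1) in auto)
    moreover have "norm (x k - norm (x' k) *\<^sub>R y k) < \<epsilon>" if k: "k \<in> {1..n+1}" for k
    proof -
      have "x' k - norm (x' k) *\<^sub>R y k = norm (x' k) *\<^sub>R (z k - y k)"
        using x'(2)[of k] by (simp add: z_def scaleR_diff_right)
      then have "norm (x' k - norm (x' k) *\<^sub>R y k) = norm (x' k) * norm (z k - y k)" by simp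
      also have "\<dots> \<le> M * norm (z k - y k)" by (intro mult_right_mono M k) simp
      also have "\<dots> < M * (\<epsilon> / (2 * M))" using y(2) k \<open>M > 0\<close> by (intro mult_strict_left_mono) auto
      also have "\<dots> = \<epsilon> / 2" using \<open>M > 0\<close> by simp
      finally show ?thesis
        using near[OF k] norm_triangle_ineq[of "x k - x' k" "x' k - norm (x' k) *\<^sub>R y k"] by simp
    qed
    ultimately show "\<exists>y :: nat \<Rightarrow> 'a. (\<forall>k\<in>{1..n+1}. y k \<in> self_adjoints) \<and>
            invertible_elem (\<Sum>k=1..n+1. (y k)\<^sup>2) \<and>
            (\<forall>k\<in>{1..n+1}. norm (x k - y k) < \<epsilon>)"
      using y(1) by (intro exI[of _ "\<lambda>k. norm (x' k) *\<^sub>R y k"] conjI ballI) simp_all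
  qed
  show ?thesis using i_ii ii_i ii_iii iii_iv iv_v v_ii by argo
qed

end
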